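(* Let $n,k,d$ be positive integers, $D=(k-1)d$, let $\xi\in\mathbb{C}$ be a primitive $k$-th root of unity, and let $I_{n,k,d}\subset S=\mathbb{C}[x_0,\ldots,x_n]$ be the ideal generated by the $k^n$ forms $(x_0+\xi^{g_1}x_1+\cdots+\xi^{g_n}x_n)^{D}$, $0\le g_j\le k-1$. Then $I_{n,k,d}$ is minimally generated by $\{\psi_{\mathbf{g}}\}_{\mathbf{g}\in\mathcal{G}_{k,n,D}}$.
   Context: $\mathbb{N}$ includes $0$. Elements of $\mathbb{Z}_k=\mathbb{Z}/k\mathbb{Z}$ are identified with their representatives in $\{0,\ldots,k-1\}$. For $\mathbf{g}=(g_0,\ldots,g_n)\in\mathbb{Z}_k^{n+1}$, the weight is the integer $\mathrm{wt}(\mathbf{g})=\sum_{j=0}^n g_j$, and $\mathcal{G}_{k,n,D}:=\{\mathbf{g}\in\mathbb{Z}_k^{n+1} : D-\mathrm{wt}(\mathbf{g})\in k\mathbb{N}\}$. The polynomial $\psi_{\mathbf{g}}$ is the part of $(x_0+\cdots+x_n)^D$ whose exponent vectors are congruent to $\mathbf{g}$ modulo $k$: $$\psi_{\mathbf{g}}=\sum_{\substack{d_0+\cdots+d_n=D\\ d_l\equiv g_l \ (\mathrm{mod}\ k)\ \forall l}}\binom{D}{d_0,\ldots,d_n}x_0^{d_0}\cdots x_n^{d_n}.$$ *)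

theory Defs
  imports Complex_Main "HOL-Library.Poly_Mapping" "HOL-Library.FuncSet"
    "HOL-Number_Theory.Cong" "HOL-Algebra.Ideal"
begin

text \<open>
  Polynomials over the complex numbers in the variables \<open>x\<^sub>0, x\<^sub>1, \<dots>\<close> are finitely supported maps
  from exponent vectors (themselves finitely supported maps from variable indices to naturals) to
  coefficients; the product of \<^theory>\<open>HOL-Library.Poly_Mapping\<close> is the convolution product.
\<close>

type_synonym mpoly = "(nat \<Rightarrow>\<^sub>0 nat) \<Rightarrow>\<^sub>0 complex"

definition Var :: "nat \<Rightarrow> mpoly"
  where "Var i = Poly_Mapping.single (Poly_Mapping.single i 1) 1"

definition Const :: "complex \<Rightarrow> mpoly"
  where "Const c = Poly_Mapping.single 0 c"

definition poly_ring :: "nat \<Rightarrow> mpoly ring"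
  where "poly_ring n =
    \<lparr>carrier = {p. \<forall>d \<in> Poly_Mapping.keys p. Poly_Mapping.keys d \<subseteq> {..n}},
     mult = (*), one = 1, zero = 0, add = (+)\<rparr>"

definition primitive_root_of_unity :: "nat \<Rightarrow> complex \<Rightarrow> bool"
  where "primitive_root_of_unity k \<xi> \<longleftrightarrow>
    k > 0 \<and> \<xi> ^ k = 1 \<and> (\<forall>j. 0 < j \<and> j < k \<longrightarrow> \<xi> ^ j \<noteq> 1)"

definition power_form :: "nat \<Rightarrow> nat \<Rightarrow> complex \<Rightarrow> (nat \<Rightarrow> nat) \<Rightarrow> mpoly"
  where "power_form n D \<xi> g = (Var 0 + (\<Sum>j=1..n. Const (\<xi> ^ g j) * Var j)) ^ D"

definition power_ideal :: "nat \<Rightarrow> nat \<Rightarrow> nat \<Rightarrow> complex \<Rightarrow> mpoly set"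
  where "power_ideal n k d \<xi> =
    Idl\<^bsub>poly_ring n\<^esub> (power_form n ((k - 1) * d) \<xi> ` ({1..n} \<rightarrow>\<^sub>E {..<k}))"

text \<open>
  A vector over the integers modulo \<open>k\<close> with entries indexed by \<open>0, \<dots>, n\<close> is represented by the
  tuple of its representatives in \<open>{0, \<dots>, k - 1}\<close>.  Extensionality makes this one-to-one,
  so that index sets of families contain no duplicates.
\<close>

definition residue_vectors :: "nat \<Rightarrow> nat \<Rightarrow> (nat \<Rightarrow> nat) set"
  where "residue_vectors k n = {..n} \<rightarrow>\<^sub>E {..<k}"

definition wt :: "nat \<Rightarrow> (nat \<Rightarrow> nat) \<Rightarrow> nat"
  where "wt n g = (\<Sum>j\<le>n. g j)"

definition \<G> :: "nat \<Rightarrow> nat \<Rightarrow> nat \<Rightarrow> (nat \<Rightarrow> nat) set"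
  where "\<G> k n D = {g \<in> residue_vectors k n. \<exists>m::nat. int D - int (wt n g) = int k * int m}"

text \<open>The division below is exact when the \<open>d\<^sub>i\<close> sum to \<open>D\<close>, the only case in which it is used.\<close>

definition multinomial :: "nat \<Rightarrow> nat \<Rightarrow> (nat \<Rightarrow>\<^sub>0 nat) \<Rightarrow> nat"
  where "multinomial n D d = fact D div (\<Prod>i\<le>n. fact (Poly_Mapping.lookup d i))"

definition exponents :: "nat \<Rightarrow> nat \<Rightarrow> nat \<Rightarrow> (nat \<Rightarrow> nat) \<Rightarrow> (nat \<Rightarrow>\<^sub>0 nat) set"
  where "exponents n k D g =
    {d. Poly_Mapping.keys d \<subseteq> {..n} \<and> (\<Sum>i\<le>n. Poly_Mapping.lookup d i) = D \<and>
        (\<forall>l\<le>n. [Poly_Mapping.lookup d l = g l] (mod k))}"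

definition \<psi> :: "nat \<Rightarrow> nat \<Rightarrow> nat \<Rightarrow> (nat \<Rightarrow> nat) \<Rightarrow> mpoly"
  where "\<psi> n k D g = (\<Sum>d\<in>exponents n k D g.
    Const (of_nat (multinomial n D d)) * (\<Prod>i\<le>n. Var i ^ Poly_Mapping.lookup d i))"

text \<open>
  Minimality is that of an indexed family: no proper subfamily generates the ideal.
  In particular the members of the family are nonzero and pairwise distinct.
\<close>

definition minimally_generates :: "('a, 'b) ring_scheme \<Rightarrow> ('i \<Rightarrow> 'a) \<Rightarrow> 'i set \<Rightarrow> 'a set \<Rightarrow> bool"
  where "minimally_generates R f A I \<longleftrightarrow>
    f ` A \<subseteq> carrier R \<and> Idl\<^bsub>R\<^esub> (f ` A) = I \<and> (\<forall>B. B \<subset> A \<longrightarrow> Idl\<^bsub>R\<^esub> (f ` B) \<noteq> I)"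


lemma poly_ring_mult_closed:
  assumes "p \<in> carrier (poly_ring n)" "q \<in> carrier (poly_ring n)"
  shows "p * q \<in> carrier (poly_ring n)"
proof -
  have "Poly_Mapping.keys d \<subseteq> {..n}" if d: "d \<in> Poly_Mapping.keys (p * q)" for d
  proof -
    obtain a b where "d = a + b" "a \<in> Poly_Mapping.keys p" "b \<in> Poly_Mapping.keys q"
      using keys_mult[of p q] d by blast
    then show ?thesis
      using assms keys_add[of a b] by (fastforce simp: poly_ring_def)
  qed
  then show ?thesis by (simp add: poly_ring_def)
qed

lemma poly_ring_add_closed:
  assumes "p \<in> carrier (poly_ring n)" "q \<in> carrier (poly_ring n)"
  shows "p + q \<in> carrier (poly_ring n)"
  using assms keys_add[of p q] by (fastforce simp: poly_ring_def)

lemma cring_poly_ring: "cring (poly_ring n)"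
proof (rule cringI)
  have neg: "- p \<in> carrier (poly_ring n)" if "p \<in> carrier (poly_ring n)" for p
    using that by (simp add: poly_ring_def)
  show "abelian_group (poly_ring n)"
  proof (rule abelian_groupI)
    fix x assume "x \<in> carrier (poly_ring n)"
    then show "\<exists>y\<in>carrier (poly_ring n). y \<oplus>\<^bsub>poly_ring n\<^esub> x = \<zero>\<^bsub>poly_ring n\<^esub>"
      using neg[of x] by (intro bexI[of _ "- x"]) (auto simp: poly_ring_def)
  next
    fix x y assume "x \<in> carrier (poly_ring n)" "y \<in> carrier (poly_ring n)"
    then show "x \<oplus>\<^bsub>poly_ring n\<^esub> y \<in> carrier (poly_ring n)"
      using poly_ring_add_closed[of x n y] by (simp add: poly_ring_def)
  qed (auto simp: poly_ring_def algebra_simps)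
  show "Group.comm_monoid (poly_ring n)"
  proof (rule comm_monoidI)
    fix x y assume "x \<in> carrier (poly_ring n)" "y \<in> carrier (poly_ring n)"
    then show "x \<otimes>\<^bsub>poly_ring n\<^esub> y \<in> carrier (poly_ring n)"
      using poly_ring_mult_closed[of x n y] by (simp add: poly_ring_def)
  qed (auto simp: poly_ring_def algebra_simps)
qed (auto simp: poly_ring_def algebra_simps)

lemma finite_exponents: "finite (exponents n k D g)"
proof -
  have "Poly_Mapping.lookup ` exponents n k D g \<subseteq>
      {f. \<forall>x. (x \<in> {..n} \<longrightarrow> f x \<in> {..D}) \<and> (x \<notin> {..n} \<longrightarrow> f x = 0)}"
  proof (clarsimp, intro conjI impI)
    fix d x assume d: "d \<in> exponents n k D g"
    show "Poly_Mapping.lookup d x \<le> D" if "x \<le> n"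
      using d that member_le_sum[of x "{..n}" "Poly_Mapping.lookup d"]
      by (auto simp: exponents_def)
    show "Poly_Mapping.lookup d x = 0" if "\<not> x \<le> n"
      using d that by (auto simp: exponents_def subset_iff Poly_Mapping.in_keys_iff)
  qed
  then have "finite (Poly_Mapping.lookup ` exponents n k D g)"
    by (rule finite_subset) (intro finite_set_of_finite_funs finite_atMost)
  then show ?thesis
    by (rule finite_imageD) (simp add: inj_on_def)
qed

end

theory Submission
  imports Defs
begin

text \<open>
  Expand \<open>(x\<^sub>0 + \<xi>\<^bsup>g\<^sub>1\<^esup> x\<^sub>1 + \<dots> + \<xi>\<^bsup>g\<^sub>n\<^esup> x\<^sub>n)\<^sup>D\<close> by the multinomial theorem.  Because \<open>\<xi>\<^sup>k = 1\<close>, the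
  powers of \<open>\<xi>\<close> in front of a monomial depend only on the residues modulo \<open>k\<close> of its exponents.
  Collecting the monomials by these residues gives, with \<open>g \<cdot> h = g\<^sub>1 h\<^sub>1 + \<dots> + g\<^sub>n h\<^sub>n\<close>, that the
  form belonging to \<open>g\<close> is the sum over \<open>h\<close> of \<open>\<xi>\<^bsup>g \<cdot> h\<^esup> \<psi>\<^sub>h\<close> (\<open>power_form_eq_sum_\<psi>\<close>).  The entry
  \<open>h\<^sub>0\<close> is absent here, but it is determined by \<open>h\<^sub>1, \<dots>, h\<^sub>n\<close>, since the weight of \<open>h\<close> is congruent
  to \<open>D\<close>.  So the passage from the \<open>\<psi>\<^sub>h\<close> to the powers is part of the discrete Fourier transform
  on the \<open>n\<close>-th power of the integers modulo \<open>k\<close>, and orthogonality of characters recovers each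
  \<open>\<psi>\<^sub>h\<close> as a linear combination of the powers (\<open>\<psi>_eq_sum_power_form\<close>).  The two families therefore
  span the same vector space and generate the same ideal.

  For minimality, all \<open>\<psi>\<^sub>h\<close> are nonzero and homogeneous of the same degree \<open>D\<close>, and no two of them
  share a monomial.  In degree \<open>D\<close> the ideal generated by some of them is just their linear span,
  so it contains none of the others (\<open>\<psi>_notin_ideal_of_others\<close>).
\<close>

section \<open>The multinomial theorem\<close>

text \<open>
  The exponent vectors of the monomials of degree \<open>D\<close> in \<open>x\<^sub>0, \<dots>, x\<^sub>n\<close>, with no condition on residues.
\<close>

definition degree_exponents :: "nat \<Rightarrow> nat \<Rightarrow> (nat \<Rightarrow>\<^sub>0 nat) set"
  where "degree_exponents n D =
    {d. Poly_Mapping.keys d \<subseteq> {..n} \<and> (\<Sum>i\<le>n. Poly_Mapping.lookup d i) = D}"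

lemma degree_exponents_eq_exponents: "degree_exponents n D = exponents n 1 D g"
  by (simp add: degree_exponents_def exponents_def)

lemma finite_degree_exponents: "finite (degree_exponents n D)"
  by (subst degree_exponents_eq_exponents) (rule finite_exponents)

lemma prod_fact_dvd_fact_sum:
  fixes a :: "nat \<Rightarrow> nat"
  shows "(\<Prod>i\<le>n. fact (a i)) dvd (fact (\<Sum>i\<le>n. a i) :: nat)"
proof (induction n)
  case (Suc n)
  have "(\<Prod>i\<le>Suc n. fact (a i)) dvd (fact (\<Sum>i\<le>n. a i) * fact (a (Suc n)) :: nat)"
    using Suc by (simp add: mult_dvd_mono)
  also have "\<dots> dvd fact ((\<Sum>i\<le>n. a i) + a (Suc n))"
    by (rule fact_fact_dvd_fact)
  finally show ?case by simp
qed simp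

lemma multinomial_mult_prod_fact:
  assumes "d \<in> degree_exponents n D"
  shows "multinomial n D d * (\<Prod>i\<le>n. fact (Poly_Mapping.lookup d i)) = fact D"
  using assms prod_fact_dvd_fact_sum[of "Poly_Mapping.lookup d" n]
  by (auto simp: multinomial_def degree_exponents_def)

lemma lookup_degree_exponents_Suc [simp]:
  "d \<in> degree_exponents n D \<Longrightarrow> Poly_Mapping.lookup d (Suc n) = 0"
  by (auto simp: degree_exponents_def subset_iff Poly_Mapping.in_keys_iff)

lemma multinomial_Suc:
  assumes d: "d \<in> degree_exponents n (D - j)" and j: "j \<le> D"
  shows "multinomial (Suc n) D (d + Poly_Mapping.single (Suc n) j) =
    (D choose j) * multinomial n (D - j) d"
proof -
  let ?P = "\<Prod>i\<le>n. fact (Poly_Mapping.lookup d i) :: nat"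
  have "fact D = (D choose j) * (fact j * fact (D - j))"
    using binomial_fact_lemma[OF j] by (simp add: algebra_simps)
  also have "fact (D - j) = multinomial n (D - j) d * ?P"
    using multinomial_mult_prod_fact[OF d] by simp
  finally have *: "fact D = ((D choose j) * multinomial n (D - j) d) * (?P * fact j)"
    by (simp add: algebra_simps)
  have "(\<Prod>i\<le>Suc n. fact (Poly_Mapping.lookup (d + Poly_Mapping.single (Suc n) j) i)) = ?P * fact j"
    using d by (simp add: lookup_add lookup_single)
  then have "multinomial (Suc n) D (d + Poly_Mapping.single (Suc n) j) = fact D div (?P * fact j)"
    by (simp only: multinomial_def)
  also have "\<dots> = (D choose j) * multinomial n (D - j) d"
    unfolding * by (rule nonzero_mult_div_cancel_right) simp
  finally show ?thesis .
qed

lemma degree_exponents_0: "degree_exponents 0 D = {Poly_Mapping.single 0 D}"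
proof -
  have "d = Poly_Mapping.single 0 D" if "d \<in> degree_exponents 0 D" for d
    using that by (intro poly_mapping_eqI)
      (auto simp: degree_exponents_def lookup_single when_def subset_iff Poly_Mapping.in_keys_iff)
  moreover have "Poly_Mapping.single 0 D \<in> degree_exponents 0 D"
    by (simp add: degree_exponents_def)
  ultimately show ?thesis by blast
qed

text \<open>
  The induction is on the number of variables: the last variable is split off by the binomial
  theorem, and a vector of degree \<open>D\<close> in \<open>n + 2\<close> variables corresponds to its last entry \<open>j\<close>
  together with a vector of degree \<open>D - j\<close> in the other variables.
\<close>

theorem multinomial_theorem:
  fixes y :: "nat \<Rightarrow> 'a::comm_semiring_1"
  shows "(\<Sum>i\<le>n. y i) ^ D =
    (\<Sum>d\<in>degree_exponents n D.
      of_nat (multinomial n D d) * (\<Prod>i\<le>n. y i ^ Poly_Mapping.lookup d i))"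
proof (induction n arbitrary: D)
  case 0
  show ?case by (simp add: degree_exponents_0 multinomial_def)
next
  case (Suc n)
  let ?u = "\<lambda>j d. d + Poly_Mapping.single (Suc n) j"
  let ?t = "\<lambda>n D d. of_nat (multinomial n D d) * (\<Prod>i\<le>n. y i ^ Poly_Mapping.lookup d i)"
  have "(\<Sum>i\<le>Suc n. y i) ^ D = (y (Suc n) + (\<Sum>i\<le>n. y i)) ^ D"
    by (simp add: add.commute)
  also have "\<dots> = (\<Sum>j\<le>D. of_nat (D choose j) * y (Suc n) ^ j * (\<Sum>i\<le>n. y i) ^ (D - j))"
    by (rule binomial_ring)
  also have "\<dots> = (\<Sum>j\<le>D. \<Sum>d\<in>degree_exponents n (D - j). ?t (Suc n) D (?u j d))"
    by (intro sum.cong refl)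
      (simp add: Suc sum_distrib_left multinomial_Suc lookup_add lookup_single mult_ac)
  also have "\<dots> = (\<Sum>(j, d)\<in>(SIGMA j:{..D}. degree_exponents n (D - j)). ?t (Suc n) D (?u j d))"
    by (rule sum.Sigma) (auto simp: finite_degree_exponents)
  also have "\<dots> = (\<Sum>d\<in>degree_exponents (Suc n) D. ?t (Suc n) D d)"
  proof (rule sum.reindex_bij_witness[where
        i = "\<lambda>d. (Poly_Mapping.lookup d (Suc n),
          d - Poly_Mapping.single (Suc n) (Poly_Mapping.lookup d (Suc n)))"
        and j = "\<lambda>(j, d). ?u j d"])
    fix a assume a: "a \<in> (SIGMA j:{..D}. degree_exponents n (D - j))"
    then obtain j d where [simp]: "a = (j, d)" and j: "j \<le> D" and d: "d \<in> degree_exponents n (D - j)"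
      by auto
    show "(\<lambda>d. (Poly_Mapping.lookup d (Suc n),
        d - Poly_Mapping.single (Suc n) (Poly_Mapping.lookup d (Suc n)))) ((\<lambda>(j, d). ?u j d) a) = a"
      using d by (simp add: lookup_add lookup_single)
    have "Poly_Mapping.keys (?u j d) \<subseteq> {..Suc n}"
      using d keys_add[of d "Poly_Mapping.single (Suc n) j"]
      by (fastforce simp: degree_exponents_def split: if_splits)
    moreover have "(\<Sum>i\<le>Suc n. Poly_Mapping.lookup (?u j d) i) = D"
      using d j by (simp add: lookup_add lookup_single) (simp add: degree_exponents_def)
    ultimately show "(\<lambda>(j, d). ?u j d) a \<in> degree_exponents (Suc n) D"
      by (simp add: degree_exponents_def)
    show "?t (Suc n) D ((\<lambda>(j, d). ?u j d) a) = (case a of (j, d) \<Rightarrow> ?t (Suc n) D (?u j d))"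
      by simp
  next
    fix d assume d: "d \<in> degree_exponents (Suc n) D"
    let ?j = "Poly_Mapping.lookup d (Suc n)"
    let ?d = "d - Poly_Mapping.single (Suc n) ?j"
    have lookup: "Poly_Mapping.lookup ?d i = (if i = Suc n then 0 else Poly_Mapping.lookup d i)" for i
      by (simp add: lookup_minus lookup_single)
    show "(\<lambda>(j, d). ?u j d) (?j, ?d) = d"
      by (rule poly_mapping_eqI) (simp add: lookup_add lookup_single lookup when_def)
    have "Poly_Mapping.keys ?d \<subseteq> {..n}"
    proof
      fix i assume "i \<in> Poly_Mapping.keys ?d"
      then have "i \<noteq> Suc n" "i \<in> Poly_Mapping.keys d"
        by (auto simp: Poly_Mapping.in_keys_iff lookup split: if_splits)
      then show "i \<in> {..n}" using d by (force simp: degree_exponents_def)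
    qed
    then show "(?j, ?d) \<in> (SIGMA j:{..D}. degree_exponents n (D - j))"
      using d by (auto simp: degree_exponents_def lookup)
  qed
  finally show ?case .
qed

section \<open>Monomials and ideals of the polynomial ring\<close>

lemma Const_simps:
  "Const a * Const b = Const (a * b)" "Const 1 = 1" "Const a ^ m = Const (a ^ m)"
  "of_nat m = Const (of_nat m)"
proof -
  show *: "Const a * Const b = Const (a * b)" for a b
    by (simp add: Const_def mult_single)
  show **: "Const 1 = 1" by (simp add: Const_def)
  show "Const a ^ m = Const (a ^ m)" by (induction m) (simp_all add: * **)
  show "of_nat m = Const (of_nat m)"
    by (simp add: Const_def)
qed

lemma Const_sum: "Const (\<Sum>a\<in>A. f a) = (\<Sum>a\<in>A. Const (f a))"
  by (rule poly_mapping_eqI) (simp add: Const_def lookup_sum lookup_single when_def)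

lemma Const_prod: "Const (\<Prod>a\<in>A. f a) = (\<Prod>a\<in>A. Const (f a))"
  by (induction A rule: infinite_finite_induct) (simp_all add: Const_simps flip: Const_simps(1))

lemma Var_power: "Var i ^ m = Poly_Mapping.single (Poly_Mapping.single i m) 1"
  by (induction m) (simp_all add: Var_def mult_single flip: single_add)

lemma prod_Var_power:
  assumes "Poly_Mapping.keys d \<subseteq> {..n}"
  shows "(\<Prod>i\<le>n. Var i ^ Poly_Mapping.lookup d i) = Poly_Mapping.single d 1"
proof -
  have "(\<Prod>i\<in>A. Var i ^ Poly_Mapping.lookup d i) =
      Poly_Mapping.single (\<Sum>i\<in>A. Poly_Mapping.single i (Poly_Mapping.lookup d i)) 1" if "finite A" for A
    using that by (induction A) (simp_all add: Var_power mult_single)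
  moreover have "(\<Sum>i\<le>n. Poly_Mapping.single i (Poly_Mapping.lookup d i)) = d"
    using assms by (intro poly_mapping_eqI)
      (auto simp: lookup_sum lookup_single when_def subset_iff Poly_Mapping.in_keys_iff)
  ultimately show ?thesis by simp
qed

lemma \<psi>_eq_sum_single:
  "\<psi> n k D g = (\<Sum>d\<in>exponents n k D g. Poly_Mapping.single d (of_nat (multinomial n D d)))"
  unfolding \<psi>_def
  by (intro sum.cong refl, subst prod_Var_power) (auto simp: exponents_def Const_def mult_single simp del: single_of_nat)

lemma lookup_\<psi>:
  "Poly_Mapping.lookup (\<psi> n k D g) d =
    (if d \<in> exponents n k D g then of_nat (multinomial n D d) else 0)"
  unfolding \<psi>_eq_sum_single
  by (simp add: lookup_sum lookup_single when_def finite_exponents)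

lemma keys_\<psi>_subset: "Poly_Mapping.keys (\<psi> n k D g) \<subseteq> exponents n k D g"
  by (auto simp: Poly_Mapping.in_keys_iff lookup_\<psi> split: if_splits)

lemma \<psi>_in_carrier: "\<psi> n k D g \<in> carrier (poly_ring n)"
  using keys_\<psi>_subset[of n k D g] by (auto simp: poly_ring_def exponents_def)

lemma Const_in_carrier: "Const c \<in> carrier (poly_ring n)"
  by (simp add: poly_ring_def Const_def)

lemma ideal_poly_ring_sum:
  assumes I: "ideal I (poly_ring n)" and f: "\<And>a. a \<in> A \<Longrightarrow> f a \<in> I"
  shows "(\<Sum>a\<in>A. Const (c a) * f a) \<in> I"
proof -
  interpret ideal I "poly_ring n" by (rule I)
  have zero: "0 \<in> I" using additive_subgroup.zero_closed[OF additive_subgroup_axioms] by (simp add: poly_ring_def)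
  have add: "p + q \<in> I" if "p \<in> I" "q \<in> I" for p q
    using additive_subgroup.a_closed[OF additive_subgroup_axioms that] by (simp add: poly_ring_def)
  have mult: "Const c * p \<in> I" if "p \<in> I" for c p
    using I_l_closed[OF that Const_in_carrier[of c n]] by (simp add: poly_ring_def)
  show ?thesis
    using f by (induction A rule: infinite_finite_induct) (auto intro: zero add mult)
qed

lemma ideal_poly_ringI:
  assumes "I \<subseteq> carrier (poly_ring n)" "0 \<in> I" "\<And>p q. p \<in> I \<Longrightarrow> q \<in> I \<Longrightarrow> p + q \<in> I"
    and mult: "\<And>p q. p \<in> carrier (poly_ring n) \<Longrightarrow> q \<in> I \<Longrightarrow> p * q \<in> I"
  shows "ideal I (poly_ring n)"
proof -
  interpret cring "poly_ring n" by (rule cring_poly_ring)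
  have inv: "\<ominus>\<^bsub>poly_ring n\<^esub> p = - p" if "p \<in> carrier (poly_ring n)" for p
    by (rule minus_equality) (use that in \<open>auto simp: poly_ring_def\<close>)
  show ?thesis
  proof (rule idealI)
    show "subgroup I (add_monoid (poly_ring n))"
    proof (rule add.subgroupI)
      fix p assume p: "p \<in> I"
      \<comment> \<open>Closure under negation follows from absorption, as \<open>- 1\<close> lies in the ring.\<close>
      then have "- p = Const (- 1) * p"
        by (metis Const_simps(2) Const_def mult_minus1 single_uminus)
      then show "\<ominus>\<^bsub>poly_ring n\<^esub> p \<in> I"
        using mult[OF Const_in_carrier p] inv p assms(1) by auto
    qed (use assms in \<open>auto simp: poly_ring_def\<close>)
    show "p \<otimes>\<^bsub>poly_ring n\<^esub> q \<in> I" "q \<otimes>\<^bsub>poly_ring n\<^esub> p \<in> I"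
      if "q \<in> I" "p \<in> carrier (poly_ring n)" for p q
      using mult[OF that(2,1)] by (simp_all add: poly_ring_def mult.commute)
  qed (rule ring_axioms)
qed

section \<open>Sorting the monomials of a power by residues\<close>

lemma residue_exponents_in_\<G>:
  assumes k: "k > 0" and d: "d \<in> degree_exponents n D"
  shows "(\<lambda>i\<in>{..n}. Poly_Mapping.lookup d i mod k) \<in> \<G> k n D"
proof -
  have "D = (\<Sum>i\<le>n. k * (Poly_Mapping.lookup d i div k) + Poly_Mapping.lookup d i mod k)"
    using d by (simp add: degree_exponents_def)
  also have "\<dots> = k * (\<Sum>i\<le>n. Poly_Mapping.lookup d i div k) +
      wt n (\<lambda>i\<in>{..n}. Poly_Mapping.lookup d i mod k)"
    unfolding wt_def sum.distrib sum_distrib_left by simp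
  finally have "int D - int (wt n (\<lambda>i\<in>{..n}. Poly_Mapping.lookup d i mod k)) =
      int k * int (\<Sum>i\<le>n. Poly_Mapping.lookup d i div k)"
    by simp
  then show ?thesis
    using k unfolding \<G>_def residue_vectors_def by (auto simp del: of_nat_sum)
qed

lemma mem_exponents_iff:
  assumes "g \<in> residue_vectors k n"
  shows "d \<in> exponents n k D g \<longleftrightarrow>
    d \<in> degree_exponents n D \<and> (\<lambda>i\<in>{..n}. Poly_Mapping.lookup d i mod k) = g"
proof -
  have "(\<forall>l\<le>n. [Poly_Mapping.lookup d l = g l] (mod k)) \<longleftrightarrow>
      (\<forall>l\<le>n. Poly_Mapping.lookup d l mod k = g l)"
    using assms by (auto simp: residue_vectors_def cong_def PiE_def Pi_def)
  also have "\<dots> \<longleftrightarrow> (\<lambda>i\<in>{..n}. Poly_Mapping.lookup d i mod k) = g"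
    using assms by (auto simp: residue_vectors_def PiE_def extensional_def fun_eq_iff)
  finally show ?thesis by (auto simp: exponents_def degree_exponents_def)
qed

lemma finite_\<G>: "finite (\<G> k n D)"
  by (rule finite_subset[of _ "residue_vectors k n"])
    (auto simp: \<G>_def residue_vectors_def intro: finite_PiE)

lemma sum_degree_exponents_by_residue:
  assumes "k > 0"
  shows "(\<Sum>d\<in>degree_exponents n D. f d) = (\<Sum>g\<in>\<G> k n D. \<Sum>d\<in>exponents n k D g. f d)"
proof -
  let ?r = "\<lambda>d. \<lambda>i\<in>{..n}. Poly_Mapping.lookup d i mod k"
  have "(\<Sum>g\<in>\<G> k n D. \<Sum>d\<in>exponents n k D g. f d) =
      (\<Sum>g\<in>\<G> k n D. \<Sum>d\<in>{d\<in>degree_exponents n D. ?r d = g}. f d)"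
    by (intro sum.cong refl) (auto simp: mem_exponents_iff \<G>_def)
  also have "\<dots> = (\<Sum>d\<in>degree_exponents n D. f d)"
    by (rule sum.group) (auto simp: finite_degree_exponents finite_\<G> residue_exponents_in_\<G> assms)
  finally show ?thesis by simp
qed

lemma exponents_nonempty:
  assumes g: "g \<in> \<G> k n D"
  obtains d where "d \<in> exponents n k D g"
proof -
  obtain m where m: "int D - int (wt n g) = int k * int m"
    using g by (auto simp: \<G>_def)
  then have D: "D = wt n g + k * m" by (metis diff_eq_eq add.commute of_nat_add of_nat_eq_iff of_nat_mult)
  \<comment> \<open>Add the whole excess \<open>D - wt n g\<close>, a multiple of \<open>k\<close>, to the exponent of \<open>x\<^sub>0\<close>.\<close>
  define f where "f i = (if i \<le> n then g i else 0) + (if i = 0 then k * m else 0)" for i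
  define d where "d = Abs_poly_mapping f"
  have "finite {i. f i \<noteq> 0}"
    by (rule finite_subset[of _ "{..n}"]) (auto simp: f_def split: if_splits)
  then have lookup: "Poly_Mapping.lookup d = f" by (simp add: d_def)
  have "Poly_Mapping.keys d \<subseteq> {..n}"
    by (auto simp: Poly_Mapping.in_keys_iff lookup f_def split: if_splits)
  moreover have "(\<Sum>i\<le>n. f i) = D"
    unfolding f_def sum.distrib D wt_def by simp
  moreover have "\<forall>l\<le>n. [f l = g l] (mod k)"
    by (auto simp: f_def cong_def)
  ultimately have "d \<in> exponents n k D g" by (simp add: exponents_def lookup)
  then show ?thesis by (rule that)
qed

lemma exponents_disjoint:
  assumes "g \<in> residue_vectors k n" "h \<in> residue_vectors k n" "d \<in> exponents n k D g"
    "d \<in> exponents n k D h"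
  shows "g = h"
  using assms by (metis mem_exponents_iff)

section \<open>The discrete Fourier transform between the two families\<close>

lemma power_mod_root_of_unity:
  fixes x :: "'a::monoid_mult"
  assumes "x ^ k = 1" and "[a = b] (mod k)"
  shows "x ^ a = x ^ b"
proof -
  have "x ^ a = x ^ (a mod k)" for a
    by (metis assms(1) div_mult_mod_eq mult_1 power_add power_mult power_one mult.commute)
  then show ?thesis using assms(2) by (metis cong_def)
qed

lemma power_form_eq_sum_\<psi>:
  assumes k: "k > 0" and \<xi>: "\<xi> ^ k = 1"
  shows "power_form n D \<xi> g = (\<Sum>h\<in>\<G> k n D. Const (\<Prod>j=1..n. (\<xi> ^ h j) ^ g j) * \<psi> n k D h)"
proof -
  \<comment> \<open>The coefficient of \<open>x\<^sub>0\<close> is \<open>1\<close>; the value of \<open>g\<close> at \<open>0\<close> plays no role.\<close>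
  define c where "c j = (if j = 0 then 1 else \<xi> ^ g j)" for j
  have ck: "c j ^ k = 1" for j
    using \<xi> by (simp add: c_def flip: power_mult) (metis mult.commute power_mult power_one)
  have "(\<Sum>j\<le>n. Const (c j) * Var j) = Var 0 + (\<Sum>j=1..n. Const (\<xi> ^ g j) * Var j)"
    by (simp add: atMost_atLeast0 sum.atLeast_Suc_atMost c_def Const_simps)
  then have "power_form n D \<xi> g = (\<Sum>j\<le>n. Const (c j) * Var j) ^ D"
    by (simp add: power_form_def)
  also have "\<dots> = (\<Sum>d\<in>degree_exponents n D. Const (\<Prod>i\<le>n. c i ^ Poly_Mapping.lookup d i) *
      (Const (of_nat (multinomial n D d)) * (\<Prod>i\<le>n. Var i ^ Poly_Mapping.lookup d i)))"
    by (simp add: multinomial_theorem power_mult_distrib prod.distrib Const_prod Const_simps mult_ac)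
  also have "\<dots> = (\<Sum>h\<in>\<G> k n D. \<Sum>d\<in>exponents n k D h. Const (\<Prod>i\<le>n. c i ^ Poly_Mapping.lookup d i) *
      (Const (of_nat (multinomial n D d)) * (\<Prod>i\<le>n. Var i ^ Poly_Mapping.lookup d i)))"
    by (rule sum_degree_exponents_by_residue[OF k])
  also have "\<dots> = (\<Sum>h\<in>\<G> k n D. Const (\<Prod>j=1..n. (\<xi> ^ h j) ^ g j) * \<psi> n k D h)"
  proof (intro sum.cong refl)
    fix h
    have "(\<Prod>i\<le>n. c i ^ Poly_Mapping.lookup d i) = (\<Prod>j=1..n. (\<xi> ^ h j) ^ g j)"
      if "d \<in> exponents n k D h" for d
    proof -
      have "(\<Prod>i\<le>n. c i ^ Poly_Mapping.lookup d i) = (\<Prod>i\<le>n. c i ^ h i)"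
        using that by (intro prod.cong refl power_mod_root_of_unity[OF ck]) (auto simp: exponents_def)
      also have "\<dots> = (\<Prod>j=1..n. (\<xi> ^ h j) ^ g j)"
        by (simp add: atMost_atLeast0 prod.atLeast_Suc_atMost c_def mult.commute flip: power_mult)
      finally show ?thesis .
    qed
    then show "(\<Sum>d\<in>exponents n k D h. Const (\<Prod>i\<le>n. c i ^ Poly_Mapping.lookup d i) *
        (Const (of_nat (multinomial n D d)) * (\<Prod>i\<le>n. Var i ^ Poly_Mapping.lookup d i))) =
        Const (\<Prod>j=1..n. (\<xi> ^ h j) ^ g j) * \<psi> n k D h"
      unfolding \<psi>_def sum_distrib_left by (intro sum.cong refl) simp
  qed
  finally show ?thesis .
qed

text \<open>The entry at \<open>0\<close> is forced by the others, because the weight is congruent to \<open>D\<close> modulo \<open>k\<close>.\<close>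

lemma \<G>_eqI:
  assumes g: "g \<in> \<G> k n D" and h: "h \<in> \<G> k n D" and eq: "\<And>j. j \<in> {1..n} \<Longrightarrow> g j = h j"
  shows "g = h"
proof -
  have lt: "g 0 < k" "h 0 < k" and res: "g \<in> residue_vectors k n" "h \<in> residue_vectors k n"
    using g h by (auto simp: \<G>_def residue_vectors_def)
  have wt: "wt n f = f 0 + (\<Sum>j=1..n. f j)" for f
    by (simp add: wt_def atMost_atLeast0 sum.atLeast_Suc_atMost)
  have "int k dvd int D - int (wt n g)" "int k dvd int D - int (wt n h)"
    using g h by (auto simp: \<G>_def)
  then have "int k dvd (int D - int (wt n h)) - (int D - int (wt n g))" by (rule dvd_diff[rotated])
  moreover have "(\<Sum>j=1..n. g j) = (\<Sum>j=1..n. h j)" using eq by (intro sum.cong) auto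
  ultimately have "int k dvd int (g 0) - int (h 0)" by (simp add: wt flip: of_nat_sum)
  then have "[g 0 = h 0] (mod k)" by (simp add: cong_iff_dvd_diff flip: cong_int_iff)
  then have "g 0 = h 0" using lt by (simp add: cong_def)
  then have "g j = h j" if "j \<le> n" for j using that eq[of j] by (cases j) auto
  then show ?thesis
    using res by (intro PiE_ext[of g "{..n}" "\<lambda>_. {..<k}"]) (auto simp: residue_vectors_def)
qed

lemma primitive_root_power_inj:
  assumes \<xi>: "primitive_root_of_unity k \<xi>" and "a < k" "b < k" "\<xi> ^ a = \<xi> ^ b"
  shows "a = b"
proof -
  have *: False if "a < b" "b < k" "\<xi> ^ a = \<xi> ^ b" for a b
  proof -
    have "\<xi> \<noteq> 0" using \<xi> by (auto simp: primitive_root_of_unity_def power_0_left)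
    then have "\<xi> ^ (b - a) = 1" using that by (simp add: power_diff)
    then show False using that \<xi> by (auto simp: primitive_root_of_unity_def)
  qed
  then show ?thesis using assms *[of a b] *[of b a] by (metis linorder_neqE_nat)
qed

text \<open>
  Orthogonality of characters.  The sum factors into one geometric sum for each coordinate
  \<open>1, \<dots>, n\<close>; if \<open>h' \<noteq> h\<close>, they differ in one of these coordinates, whose geometric sum vanishes.
\<close>

lemma sum_characters:
  assumes \<xi>: "primitive_root_of_unity k \<xi>" and h: "h \<in> \<G> k n D" and h': "h' \<in> \<G> k n D"
  shows "(\<Sum>g\<in>{1..n} \<rightarrow>\<^sub>E {..<k}. (\<Prod>j=1..n. (1 / \<xi> ^ h j) ^ g j) * (\<Prod>j=1..n. (\<xi> ^ h' j) ^ g j)) =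
    (if h' = h then of_nat k ^ n else 0)"
proof -
  have k: "\<xi> ^ k = 1" and nz: "\<xi> \<noteq> 0"
    using \<xi> by (auto simp: primitive_root_of_unity_def power_0_left)
  have power_power_eq_1: "(\<xi> ^ m) ^ k = 1" for m
    by (metis k mult.commute power_mult power_one)
  define z where "z j = \<xi> ^ h' j / \<xi> ^ h j" for j
  have "(\<Sum>g\<in>{1..n} \<rightarrow>\<^sub>E {..<k}. (\<Prod>j=1..n. (1 / \<xi> ^ h j) ^ g j) * (\<Prod>j=1..n. (\<xi> ^ h' j) ^ g j)) =
      (\<Sum>g\<in>{1..n} \<rightarrow>\<^sub>E {..<k}. \<Prod>j=1..n. z j ^ g j)"
    by (intro sum.cong refl) (simp add: z_def power_divide flip: prod.distrib)
  also have "\<dots> = (\<Prod>j=1..n. \<Sum>m<k. z j ^ m)"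
    by (rule prod_sum_PiE[symmetric]) auto
  also have "\<dots> = (if h' = h then of_nat k ^ n else 0)"
  proof (cases "h' = h")
    case True
    then show ?thesis using nz by (simp add: z_def)
  next
    case False
    then obtain j where j: "j \<in> {1..n}" "h' j \<noteq> h j" using \<G>_eqI[OF h' h] by blast
    have "h j < k" "h' j < k" using j h h' by (auto simp: \<G>_def residue_vectors_def)
    then have "\<xi> ^ h' j \<noteq> \<xi> ^ h j" using primitive_root_power_inj[OF \<xi>] j by blast
    then have "z j \<noteq> 1" using nz by (simp add: z_def)
    moreover have "z j ^ k = 1"
      using k by (simp add: z_def power_divide power_power_eq_1)
    ultimately have "(\<Sum>m<k. z j ^ m) = 0" by (simp add: geometric_sum)
    then show ?thesis using j False by auto
  qed
  finally show ?thesis .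
qed

lemma \<psi>_eq_sum_power_form:
  assumes \<xi>: "primitive_root_of_unity k \<xi>" and h: "h \<in> \<G> k n D"
  shows "\<psi> n k D h = (\<Sum>g\<in>{1..n} \<rightarrow>\<^sub>E {..<k}.
    Const ((\<Prod>j=1..n. (1 / \<xi> ^ h j) ^ g j) / of_nat k ^ n) * power_form n D \<xi> g)"
proof -
  have k: "k > 0" and \<xi>k: "\<xi> ^ k = 1" using \<xi> by (auto simp: primitive_root_of_unity_def)
  define a where "a g = (\<Prod>j=1..n. (1 / \<xi> ^ h j) ^ g j)" for g :: "nat \<Rightarrow> nat"
  define b where "b h' g = (\<Prod>j=1..n. (\<xi> ^ h' j) ^ g j)" for h' g :: "nat \<Rightarrow> nat"
  have "(\<Sum>g\<in>{1..n} \<rightarrow>\<^sub>E {..<k}. Const (a g / of_nat k ^ n) * power_form n D \<xi> g) =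
      (\<Sum>g\<in>{1..n} \<rightarrow>\<^sub>E {..<k}. \<Sum>h'\<in>\<G> k n D. Const (a g * b h' g / of_nat k ^ n) * \<psi> n k D h')"
    unfolding power_form_eq_sum_\<psi>[OF k \<xi>k] b_def[symmetric] sum_distrib_left
    by (simp add: Const_simps(1) flip: mult.assoc)
  also have "\<dots> = (\<Sum>h'\<in>\<G> k n D. Const ((\<Sum>g\<in>{1..n} \<rightarrow>\<^sub>E {..<k}. a g * b h' g) / of_nat k ^ n) * \<psi> n k D h')"
    by (subst sum.swap) (simp add: Const_sum sum_distrib_right sum_divide_distrib)
  also have "\<dots> = (\<Sum>h'\<in>\<G> k n D. if h' = h then \<psi> n k D h' else 0)"
  proof (intro sum.cong refl)
    fix h' assume "h' \<in> \<G> k n D"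
    then have "(\<Sum>g\<in>{1..n} \<rightarrow>\<^sub>E {..<k}. a g * b h' g) = (if h' = h then of_nat k ^ n else 0)"
      unfolding a_def b_def by (rule sum_characters[OF \<xi> h])
    moreover have "Const 0 = 0" by (simp add: Const_def)
    ultimately show "Const ((\<Sum>g\<in>{1..n} \<rightarrow>\<^sub>E {..<k}. a g * b h' g) / of_nat k ^ n) * \<psi> n k D h' =
        (if h' = h then \<psi> n k D h' else 0)"
      using k by (simp add: Const_simps(2))
  qed
  also have "\<dots> = \<psi> n k D h"
    using h by (simp add: finite_\<G>)
  finally show ?thesis by (simp add: a_def)
qed

section \<open>Minimality\<close>

text \<open>
  The polynomials all of whose monomials have degree at least \<open>D\<close> and do not occur in \<open>\<psi>\<^sub>h\<close> form an
  ideal \<open>J\<close>: a monomial of \<open>\<psi>\<^sub>h\<close> has degree \<open>D\<close>, so multiplying a monomial of degree at least \<open>D\<close>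
  can only produce it from itself, with factor \<open>1\<close>.  The ideal \<open>J\<close> contains all the other \<open>\<psi>\<^sub>g\<close>, but not \<open>\<psi>\<^sub>h\<close>.
\<close>

lemma \<psi>_notin_ideal_of_others:
  assumes B: "B \<subseteq> \<G> k n D" and h: "h \<in> \<G> k n D" "h \<notin> B"
  shows "\<psi> n k D h \<notin> Idl\<^bsub>poly_ring n\<^esub> (\<psi> n k D ` B)"
proof -
  interpret cring "poly_ring n" by (rule cring_poly_ring)
  define deg where "deg d = (\<Sum>i\<le>n. Poly_Mapping.lookup d i)" for d :: "nat \<Rightarrow>\<^sub>0 nat"
  define J where "J = {p \<in> carrier (poly_ring n).
    \<forall>d\<in>Poly_Mapping.keys p. D \<le> deg d \<and> d \<notin> exponents n k D h}"
  have "ideal J (poly_ring n)"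
  proof (rule ideal_poly_ringI)
    fix p q assume "p \<in> J" "q \<in> J"
    then show "p + q \<in> J"
      using keys_add[of p q] poly_ring_add_closed[of p n q] by (auto simp: J_def)
  next
    fix p q assume p: "p \<in> carrier (poly_ring n)" and q: "q \<in> J"
    have "D \<le> deg d \<and> d \<notin> exponents n k D h" if d: "d \<in> Poly_Mapping.keys (p * q)" for d
    proof -
      obtain a b where ab: "d = a + b" "a \<in> Poly_Mapping.keys p" "b \<in> Poly_Mapping.keys q"
        using keys_mult[of p q] d by blast
      have deg: "deg d = deg a + deg b" by (simp add: deg_def ab lookup_add sum.distrib)
      have b: "D \<le> deg b" "b \<notin> exponents n k D h" using q ab by (auto simp: J_def)
      have "d \<notin> exponents n k D h"
      proof
        assume *: "d \<in> exponents n k D h"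
        then have "deg a = 0" using deg b by (simp add: exponents_def deg_def)
        moreover have "Poly_Mapping.keys a \<subseteq> {..n}" using p ab by (auto simp: poly_ring_def)
        ultimately have "a = 0"
          by (intro poly_mapping_eqI) (auto simp: deg_def subset_iff Poly_Mapping.in_keys_iff)
        then show False using * b ab by simp
      qed
      then show ?thesis using deg b by simp
    qed
    moreover have "p * q \<in> carrier (poly_ring n)"
      using p q by (intro poly_ring_mult_closed) (auto simp: J_def)
    ultimately show "p * q \<in> J" by (simp add: J_def)
  qed (auto simp: J_def poly_ring_def)
  moreover have "\<psi> n k D g \<in> J" if "g \<in> B" for g
  proof -
    have "g \<in> residue_vectors k n" "h \<in> residue_vectors k n" "g \<noteq> h"
      using that B h by (auto simp: \<G>_def)
    then have "d \<notin> exponents n k D h" if "d \<in> exponents n k D g" for d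
      using exponents_disjoint that by blast
    then show ?thesis
      using keys_\<psi>_subset[of n k D g] \<psi>_in_carrier[of n k D g]
      by (fastforce simp: J_def deg_def exponents_def)
  qed
  ultimately have "Idl\<^bsub>poly_ring n\<^esub> (\<psi> n k D ` B) \<subseteq> J"
    by (intro genideal_minimal) auto
  moreover have "\<psi> n k D h \<notin> J"
  proof -
    obtain d where d: "d \<in> exponents n k D h" using exponents_nonempty[OF h(1)] .
    then have "d \<in> degree_exponents n D" by (simp add: exponents_def degree_exponents_def)
    then have "multinomial n D d \<noteq> 0"
      using multinomial_mult_prod_fact[of d n D] by (metis fact_nonzero mult_0)
    then have "d \<in> Poly_Mapping.keys (\<psi> n k D h)"
      using d by (simp add: Poly_Mapping.in_keys_iff lookup_\<psi>)
    then show ?thesis using d by (auto simp: J_def)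
  qed
  ultimately show ?thesis by blast
qed

theorem proposition2p5:
  fixes n k d :: nat and \<xi> :: complex
  assumes "n > 0" and "k > 0" and "d > 0"
    and "primitive_root_of_unity k \<xi>"
  shows "minimally_generates (poly_ring n) (\<psi> n k ((k - 1) * d)) (\<G> k n ((k - 1) * d))
           (power_ideal n k d \<xi>)"
proof -
  interpret cring "poly_ring n" by (rule cring_poly_ring)
  define D where "D = (k - 1) * d"
  let ?P = "power_form n D \<xi> ` ({1..n} \<rightarrow>\<^sub>E {..<k})" and ?Q = "\<psi> n k D ` \<G> k n D"
  have Q: "?Q \<subseteq> carrier (poly_ring n)" using \<psi>_in_carrier by blast
  have idealQ: "ideal (Idl\<^bsub>poly_ring n\<^esub> ?Q) (poly_ring n)" using Q by (rule genideal_ideal)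
  have PQ: "?P \<subseteq> Idl\<^bsub>poly_ring n\<^esub> ?Q"
  proof clarify
    fix g
    have \<xi>: "\<xi> ^ k = 1" using assms(4) by (simp add: primitive_root_of_unity_def)
    show "power_form n D \<xi> g \<in> Idl\<^bsub>poly_ring n\<^esub> ?Q"
      unfolding power_form_eq_sum_\<psi>[OF assms(2) \<xi>]
      using genideal_self[OF Q] by (intro ideal_poly_ring_sum[OF idealQ]) blast
  qed
  have P: "?P \<subseteq> carrier (poly_ring n)"
    using PQ ideal.Icarr[OF idealQ] by blast
  have idealP: "ideal (Idl\<^bsub>poly_ring n\<^esub> ?P) (poly_ring n)" using P by (rule genideal_ideal)
  have "?Q \<subseteq> Idl\<^bsub>poly_ring n\<^esub> ?P"
  proof clarify
    fix h assume h: "h \<in> \<G> k n D"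
    show "\<psi> n k D h \<in> Idl\<^bsub>poly_ring n\<^esub> ?P"
      unfolding \<psi>_eq_sum_power_form[OF assms(4) h]
      using genideal_self[OF P] by (intro ideal_poly_ring_sum[OF idealP]) blast
  qed
  then have "Idl\<^bsub>poly_ring n\<^esub> ?Q = Idl\<^bsub>poly_ring n\<^esub> ?P"
    using PQ genideal_minimal idealP idealQ by (intro equalityI) auto
  moreover have "Idl\<^bsub>poly_ring n\<^esub> (\<psi> n k D ` B) \<noteq> Idl\<^bsub>poly_ring n\<^esub> ?Q" if B: "B \<subset> \<G> k n D" for B
  proof -
    obtain h where h: "h \<in> \<G> k n D" "h \<notin> B" using B by blast
    then have "\<psi> n k D h \<notin> Idl\<^bsub>poly_ring n\<^esub> (\<psi> n k D ` B)"
      using \<psi>_notin_ideal_of_others B by blast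
    then show ?thesis using genideal_self[OF Q] h by blast
  qed
  ultimately show ?thesis
    using Q unfolding minimally_generates_def power_ideal_def D_def by simp
qed

end
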